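(* Let $G$ be a group (not necessarily finite) and let $e$ be an idempotent of the rational group ring $\mathbb{Q}G$. Let $\beta\in\mathbb{Z}$ be such that $u=\beta e\in\mathbb{Z}G$. Let $p$ be a prime and let $q = q'\cdot m$ be a positive integer such that $m$ is the $p$-part of $q$ and $q'$ is not divisible by $p$. For $s\in G$ and positive integers $r,t$ with $r\mid t\mid q'$, let $C_{r,t}(s)$ denote the set of conjugacy classes $x^{G}$ of $G$ for which $x^{m}$ is conjugate to $s$ in $G$ and there exists $y\in G$ with $y^{qr/t}=x^{m}$. If $p$ does not divide $\beta$, then for every $s\in G$ we have $$\nu_{s}(u) \equiv \sum_{(r,t):\ r \mid t \mid q'} \mu(r) \cdot \Big( \sum_{x^{G}\in C_{r,t}(s)} \nu_{x}(u) \Big) \pmod p,$$ where the outer sum runs over all pairs $(r,t)$ of positive integers with $r\mid t$ and $t\mid q'$. Moreover, if in addition $G$ is finite and $p>4q'\cdot|\beta|\cdot|G|^{3/2}$, then for every $s\in G$ equality holds: $$\nu_{s}(u) = \sum_{(r,t):\ r \mid t \mid q'} \mu(r) \cdot \Big( \sum_{x^{G}\in C_{r,t}(s)} \nu_{x}(u) \Big).$$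
   Context: For $g\in G$, $g^G$ denotes the conjugacy class of $g$ in $G$. For $w=\sum_{g\in G}\alpha_g g$ in a group ring of $G$ (finitely many nonzero coefficients $\alpha_g$) and $y\in G$, the partial augmentation of $w$ with respect to $y$ is $\nu_y(w)=\sum_{g\in y^G}\alpha_g$; it depends only on the conjugacy class of $y$, and for a given $w$ it is nonzero for only finitely many classes, so the inner sum has only finitely many nonzero terms. The $p$-part of a positive integer $q$ is the largest power of $p$ dividing $q$. $\mu$ is the Möbius function on positive integers: $\mu(1)=1$, $\mu(n)=0$ if $n$ is divisible by the square of a prime, and $\mu(n)=(-1)^{\ell}$ if $n$ is a product of $\ell$ distinct primes. The condition defining $C_{r,t}(s)$ does not depend on the representative $x$ of the class $x^G$; each class is counted once in the inner sum. *)

theory Defs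
  imports
    Complex_Main
    "HOL-Algebra.Coset"
    "HOL-Algebra.Ring"
    "HOL-Number_Theory.Cong"
    "HOL-Library.Poly_Mapping"
begin

text \<open>
  Elements of the group ring are finitely supported functions from the group to the
  coefficients. The library instantiates multiplication on \<open>'g \<Rightarrow>\<^sub>0 'r\<close> only for
  additively written monoids that fill a whole type, so the convolution product with respect to
  the multiplication of \<open>G\<close> is defined here.
\<close>

definition convolution ::
  "('g, 'm) monoid_scheme \<Rightarrow> ('g \<Rightarrow>\<^sub>0 'r) \<Rightarrow> ('g \<Rightarrow>\<^sub>0 'r) \<Rightarrow> ('g \<Rightarrow>\<^sub>0 'r::comm_ring_1)" where
  "convolution G v w =
     (\<Sum>x\<in>Poly_Mapping.keys v. \<Sum>y\<in>Poly_Mapping.keys w. Poly_Mapping.single (x \<otimes>\<^bsub>G\<^esub> y) (Poly_Mapping.lookup v x * Poly_Mapping.lookup w y))"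

definition group_ring :: "('g, 'm) monoid_scheme \<Rightarrow> ('g \<Rightarrow>\<^sub>0 'r::comm_ring_1) ring" where
  "group_ring G =
     \<lparr>carrier = {w. Poly_Mapping.keys w \<subseteq> carrier G}, monoid.mult = convolution G,
      one = Poly_Mapping.single \<one>\<^bsub>G\<^esub> 1, zero = 0, add = (+)\<rparr>"

definition conj_class :: "('g, 'm) monoid_scheme \<Rightarrow> 'g \<Rightarrow> 'g set" where
  "conj_class G x = {g \<otimes>\<^bsub>G\<^esub> x \<otimes>\<^bsub>G\<^esub> inv\<^bsub>G\<^esub> g | g. g \<in> carrier G}"

text \<open>
  Partial augmentations only depend on the conjugacy class; \<open>class_aug\<close> takes the class itself,
  so that sums over classes need no choice of representatives. A class may be infinite, hence the
  restriction to the support.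
\<close>

definition class_aug :: "('g \<Rightarrow>\<^sub>0 'r::comm_monoid_add) \<Rightarrow> 'g set \<Rightarrow> 'r" where
  "class_aug w X = (\<Sum>g\<in>X \<inter> Poly_Mapping.keys w. Poly_Mapping.lookup w g)"

definition partial_aug ::
  "('g, 'm) monoid_scheme \<Rightarrow> ('g \<Rightarrow>\<^sub>0 'r::comm_monoid_add) \<Rightarrow> 'g \<Rightarrow> 'r" where
  "partial_aug G w y = class_aug w (conj_class G y)"

definition moebius :: "nat \<Rightarrow> int" where
  "moebius n = (if \<exists>d. prime d \<and> d\<^sup>2 dvd n then 0 else (-1) ^ card (prime_factors n))"

text \<open>The set \<open>C\<^bsub>r,t\<^esub>(s)\<close>; it is used for \<open>t\<close> dividing \<open>q\<close>, so the division is exact.\<close>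

definition power_classes ::
  "('g, 'm) monoid_scheme \<Rightarrow> nat \<Rightarrow> nat \<Rightarrow> nat \<Rightarrow> nat \<Rightarrow> 'g \<Rightarrow> 'g set set" where
  "power_classes G q m r t s =
     {conj_class G x | x. x \<in> carrier G \<and> x [^]\<^bsub>G\<^esub> m \<in> conj_class G s \<and>
        (\<exists>y\<in>carrier G. y [^]\<^bsub>G\<^esub> (q * r div t) = x [^]\<^bsub>G\<^esub> m)}"

text \<open>
  The right-hand side \<open>\<Sum>\<^bsub>r | t | q'\<^esub> \<mu>(r) \<Sum>\<^bsub>X \<in> C(r,t,s)\<^esub> \<nu>\<^bsub>X\<^esub>(u)\<close>. The group may have infinitely
  many classes, so the inner sum runs over the finitely many classes with nonzero partial
  augmentation (see \<open>finite_class_aug_nonzero\<close> below).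
\<close>

definition moebius_class_sum ::
  "('g, 'm) monoid_scheme \<Rightarrow> nat \<Rightarrow> nat \<Rightarrow> nat \<Rightarrow> ('g \<Rightarrow>\<^sub>0 int) \<Rightarrow> 'g \<Rightarrow> int" where
  "moebius_class_sum G q q' m u s =
     (\<Sum>(r, t)\<in>{(r, t). r dvd t \<and> t dvd q'}. moebius r *
        (\<Sum>X\<in>{X \<in> power_classes G q m r t s. class_aug u X \<noteq> 0}. class_aug u X))"

lemma (in group) conj_class_self: "x \<in> carrier G \<Longrightarrow> x \<in> conj_class G x"
  unfolding conj_class_def by (rule CollectI, rule exI[of _ \<one>]) simp

lemma (in group) conj_class_eq:
  assumes x: "x \<in> carrier G" and y: "y \<in> conj_class G x"
  shows "conj_class G y = conj_class G x"
proof -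
  obtain g where g: "g \<in> carrier G" and y_eq: "y = g \<otimes> x \<otimes> inv g"
    using y unfolding conj_class_def by blast
  have conj_mult: "h \<otimes> (k \<otimes> z \<otimes> inv k) \<otimes> inv h = (h \<otimes> k) \<otimes> z \<otimes> inv (h \<otimes> k)"
    if "h \<in> carrier G" "k \<in> carrier G" "z \<in> carrier G" for h k z
    using that by (simp add: m_assoc inv_mult_group)
  have yc: "y \<in> carrier G" using x g y_eq by simp
  have x_eq: "x = inv g \<otimes> y \<otimes> inv (inv g)"
    using conj_mult[of "inv g" g x] g x y_eq by simp
  show ?thesis
  proof
    show "conj_class G y \<subseteq> conj_class G x"
      unfolding conj_class_def y_eq using conj_mult[OF _ g x] g by auto
    show "conj_class G x \<subseteq> conj_class G y"
    proof
      fix z assume "z \<in> conj_class G x"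
      then obtain h where h: "h \<in> carrier G" and z: "z = h \<otimes> x \<otimes> inv h"
        unfolding conj_class_def by blast
      have "z = (h \<otimes> inv g) \<otimes> y \<otimes> inv (h \<otimes> inv g)"
        using conj_mult[OF h _ yc, of "inv g"] g z x_eq by simp
      then show "z \<in> conj_class G y"
        unfolding conj_class_def using h g by blast
    qed
  qed
qed

lemma (in group) finite_class_aug_nonzero:
  "finite {X \<in> power_classes G q m r t s. class_aug w X \<noteq> 0}"
proof (rule finite_subset)
  show "{X \<in> power_classes G q m r t s. class_aug w X \<noteq> 0} \<subseteq> conj_class G ` Poly_Mapping.keys w"
  proof
    fix X assume X: "X \<in> {X \<in> power_classes G q m r t s. class_aug w X \<noteq> 0}"
    then obtain x where x: "x \<in> carrier G" "X = conj_class G x"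
      unfolding power_classes_def by blast
    have "X \<inter> Poly_Mapping.keys w \<noteq> {}" using X unfolding class_aug_def by auto
    then obtain g where "g \<in> X" "g \<in> Poly_Mapping.keys w" by blast
    then show "X \<in> conj_class G ` Poly_Mapping.keys w" using conj_class_eq[OF x(1)] x(2) by blast
  qed
qed simp

lemma convolution_superset:
  assumes "finite A" "Poly_Mapping.keys v \<subseteq> A" "finite B" "Poly_Mapping.keys w \<subseteq> B"
  shows "convolution G v w =
    (\<Sum>x\<in>A. \<Sum>y\<in>B. Poly_Mapping.single (x \<otimes>\<^bsub>G\<^esub> y) (Poly_Mapping.lookup v x * Poly_Mapping.lookup w y))"
proof -
  have inner: "(\<Sum>y\<in>Poly_Mapping.keys w. Poly_Mapping.single (x \<otimes>\<^bsub>G\<^esub> y) (Poly_Mapping.lookup v x * Poly_Mapping.lookup w y)) =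
      (\<Sum>y\<in>B. Poly_Mapping.single (x \<otimes>\<^bsub>G\<^esub> y) (Poly_Mapping.lookup v x * Poly_Mapping.lookup w y))" for x
    using assms by (intro sum.mono_neutral_left) (auto simp: in_keys_iff)
  show ?thesis unfolding convolution_def inner
    using assms by (intro sum.mono_neutral_left) (auto simp: in_keys_iff)
qed

lemma convolution_add_left: "convolution G (u + v) w = convolution G u w + convolution G v w"
proof -
  let ?A = "Poly_Mapping.keys u \<union> Poly_Mapping.keys v"
  have 1: "finite ?A" and 2: "Poly_Mapping.keys (u + v) \<subseteq> ?A" by (simp_all add: Poly_Mapping.keys_add)
  have 3: "Poly_Mapping.keys u \<subseteq> ?A" "Poly_Mapping.keys v \<subseteq> ?A" by auto
  show ?thesis
    unfolding convolution_superset[OF 1 2 finite_keys order_refl]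
      convolution_superset[OF 1 3(1) finite_keys order_refl]
      convolution_superset[OF 1 3(2) finite_keys order_refl]
    by (simp add: lookup_add distrib_right single_add sum.distrib)
qed

lemma convolution_add_right: "convolution G u (v + w) = convolution G u v + convolution G u w"
proof -
  let ?A = "Poly_Mapping.keys v \<union> Poly_Mapping.keys w"
  have 1: "finite ?A" and 2: "Poly_Mapping.keys (v + w) \<subseteq> ?A" by (simp_all add: Poly_Mapping.keys_add)
  have 3: "Poly_Mapping.keys v \<subseteq> ?A" "Poly_Mapping.keys w \<subseteq> ?A" by auto
  show ?thesis
    unfolding convolution_superset[OF finite_keys order_refl 1 2]
      convolution_superset[OF finite_keys order_refl 1 3(1)]
      convolution_superset[OF finite_keys order_refl 1 3(2)]
    by (simp add: lookup_add distrib_left single_add sum.distrib)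
qed

lemma convolution_zero [simp]: "convolution G 0 w = 0" "convolution G w 0 = 0"
  by (simp_all add: convolution_def)

lemma convolution_sum_left:
  "convolution G (\<Sum>i\<in>I. f i) w = (\<Sum>i\<in>I. convolution G (f i) w)"
  by (induction I rule: infinite_finite_induct) (simp_all add: convolution_add_left)

lemma convolution_sum_right:
  "convolution G w (\<Sum>i\<in>I. f i) = (\<Sum>i\<in>I. convolution G w (f i))"
  by (induction I rule: infinite_finite_induct) (simp_all add: convolution_add_right)

lemma convolution_single:
  "convolution G (Poly_Mapping.single x a) (Poly_Mapping.single y b) =
     Poly_Mapping.single (x \<otimes>\<^bsub>G\<^esub> y) (a * b)"
  by (subst convolution_superset[of "{x}" _ "{y}"]) auto

lemma poly_mapping_sum_single: "w = (\<Sum>x\<in>Poly_Mapping.keys w. Poly_Mapping.single x (Poly_Mapping.lookup w x))"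
  by (rule poly_mapping_eqI)
    (simp add: lookup_sum lookup_single when_def in_keys_iff sum.delta)

lemma keys_convolution: "Poly_Mapping.keys (convolution G v w) \<subseteq> {x \<otimes>\<^bsub>G\<^esub> y | x y. x \<in> Poly_Mapping.keys v \<and> y \<in> Poly_Mapping.keys w}"
proof
  fix z assume z: "z \<in> Poly_Mapping.keys (convolution G v w)"
  show "z \<in> {x \<otimes>\<^bsub>G\<^esub> y | x y. x \<in> Poly_Mapping.keys v \<and> y \<in> Poly_Mapping.keys w}"
  proof (rule ccontr)
    assume n: "z \<notin> {x \<otimes>\<^bsub>G\<^esub> y | x y. x \<in> Poly_Mapping.keys v \<and> y \<in> Poly_Mapping.keys w}"
    have "Poly_Mapping.lookup (convolution G v w) z = 0"
      unfolding convolution_def lookup_sum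
      using n by (intro sum.neutral ballI) (auto simp: lookup_single when_def)
    with z show False by (simp add: in_keys_iff)
  qed
qed

lemma (in group) convolution_assoc:
  fixes u v w :: "'a \<Rightarrow>\<^sub>0 'r::comm_ring_1"
  assumes "Poly_Mapping.keys u \<subseteq> carrier G" "Poly_Mapping.keys v \<subseteq> carrier G"
    "Poly_Mapping.keys w \<subseteq> carrier G"
  shows "convolution G (convolution G u v) w = convolution G u (convolution G v w)"
proof -
  let ?s = "\<lambda>w::'a \<Rightarrow>\<^sub>0 'r. \<Sum>x\<in>Poly_Mapping.keys w. Poly_Mapping.single x (Poly_Mapping.lookup w x)"
  have "convolution G (convolution G (?s u) (?s v)) (?s w) =
      convolution G (?s u) (convolution G (?s v) (?s w))"
    unfolding convolution_sum_left convolution_sum_right convolution_single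
    using assms
    by (subst sum.swap, subst (2) sum.swap, intro sum.cong refl)
      (auto simp: m_assoc mult.assoc subset_iff)
  then show ?thesis by (simp only: poly_mapping_sum_single[symmetric])
qed

lemma (in group) ring_group_ring: "ring (group_ring G :: ('a \<Rightarrow>\<^sub>0 'r::comm_ring_1) ring)"
proof (rule ringI)
  show "abelian_group (group_ring G :: ('a \<Rightarrow>\<^sub>0 'r) ring)"
  proof (rule abelian_groupI)
    fix x :: "'a \<Rightarrow>\<^sub>0 'r" assume "x \<in> carrier (group_ring G)"
    then show "\<exists>y\<in>carrier (group_ring G). y \<oplus>\<^bsub>group_ring G\<^esub> x = \<zero>\<^bsub>group_ring G\<^esub>"
      by (intro bexI[of _ "- x"]) (auto simp: group_ring_def in_keys_iff subset_iff)
  next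
    fix x y :: "'a \<Rightarrow>\<^sub>0 'r" assume "x \<in> carrier (group_ring G)" "y \<in> carrier (group_ring G)"
    then show "x \<oplus>\<^bsub>group_ring G\<^esub> y \<in> carrier (group_ring G)"
      using Poly_Mapping.keys_add[of x y] by (auto simp: group_ring_def)
  qed (simp_all add: group_ring_def ac_simps)
  show "Group.monoid (group_ring G :: ('a \<Rightarrow>\<^sub>0 'r) ring)"
  proof (rule monoidI)
    fix x y :: "'a \<Rightarrow>\<^sub>0 'r" assume "x \<in> carrier (group_ring G)" "y \<in> carrier (group_ring G)"
    then show "x \<otimes>\<^bsub>group_ring G\<^esub> y \<in> carrier (group_ring G)"
      using keys_convolution[of G x y] by (fastforce simp: group_ring_def)
  next
    show "\<one>\<^bsub>group_ring G\<^esub> \<in> carrier (group_ring G :: ('a \<Rightarrow>\<^sub>0 'r) ring)"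
      by (simp add: group_ring_def)
  next
    fix x y z :: "'a \<Rightarrow>\<^sub>0 'r"
    assume "x \<in> carrier (group_ring G)" "y \<in> carrier (group_ring G)" "z \<in> carrier (group_ring G)"
    then show "x \<otimes>\<^bsub>group_ring G\<^esub> y \<otimes>\<^bsub>group_ring G\<^esub> z = x \<otimes>\<^bsub>group_ring G\<^esub> (y \<otimes>\<^bsub>group_ring G\<^esub> z)"
      by (simp add: group_ring_def convolution_assoc)
  next
    fix x :: "'a \<Rightarrow>\<^sub>0 'r" assume x: "x \<in> carrier (group_ring G)"
    have 1: "Poly_Mapping.keys (Poly_Mapping.single \<one> (1::'r)) \<subseteq> {\<one>}" by simp
    have "convolution G (Poly_Mapping.single \<one> 1) x
        = (\<Sum>y\<in>Poly_Mapping.keys x. Poly_Mapping.single (\<one> \<otimes> y) (Poly_Mapping.lookup x y))"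
      by (subst convolution_superset[OF _ 1 finite_keys order_refl]) simp_all
    also have "\<dots> = (\<Sum>y\<in>Poly_Mapping.keys x. Poly_Mapping.single y (Poly_Mapping.lookup x y))"
      using x by (intro sum.cong refl) (auto simp: group_ring_def subset_iff)
    finally show "\<one>\<^bsub>group_ring G\<^esub> \<otimes>\<^bsub>group_ring G\<^esub> x = x"
      by (simp add: group_ring_def poly_mapping_sum_single[symmetric])
    have "convolution G x (Poly_Mapping.single \<one> 1)
        = (\<Sum>y\<in>Poly_Mapping.keys x. Poly_Mapping.single (y \<otimes> \<one>) (Poly_Mapping.lookup x y))"
      by (subst convolution_superset[OF finite_keys order_refl _ 1]) simp_all
    also have "\<dots> = (\<Sum>y\<in>Poly_Mapping.keys x. Poly_Mapping.single y (Poly_Mapping.lookup x y))"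
      using x by (intro sum.cong refl) (auto simp: group_ring_def subset_iff)
    finally show "x \<otimes>\<^bsub>group_ring G\<^esub> \<one>\<^bsub>group_ring G\<^esub> = x"
      by (simp add: group_ring_def poly_mapping_sum_single[symmetric])
  qed
qed (simp_all add: group_ring_def convolution_add_left convolution_add_right)

end

theory Submission
  imports Defs "HOL-Number_Theory.Residues"
begin

text \<open>
  Let \<open>\<nu>\<^sub>P(u)\<close> be the sum of the coefficients of \<open>u\<close> over the elements with a conjugation invariant
  property \<open>P\<close>. Expand \<open>\<nu>\<^sub>P(u^(p^(n+1)))\<close> over words of length \<open>p^(n+1)\<close> in the support of \<open>u\<close> and
  group them by cyclic rotation: modulo \<open>p^(n+1)\<close> only the \<open>p\<close>-th powers of words contribute, and
  they give \<open>\<nu>\<^sub>Q(u^(p^n))\<close> with \<open>Q(g) = P(g^p)\<close>. Since \<open>u^(k+1) = \<beta>^k u\<close> and \<open>p\<close> does not divide \<open>\<beta>\<close>,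
  this yields \<open>\<nu>\<^sub>P(u) \<equiv> \<nu>\<^sub>Q(u)\<close> modulo every power of \<open>p\<close>, hence \<open>\<nu>\<^sub>P(u) = \<nu>\<^sub>Q(u)\<close>. Iterating, \<open>\<nu>\<^sub>s(u)\<close> is the sum of the coefficients at the \<open>g\<close> with \<open>g^m\<close>
  conjugate to \<open>s\<close>, and Moebius inversion shows that the right-hand side is the same sum.
\<close>

subsection \<open>Congruences modulo prime powers\<close>

text \<open>The difference \<open>a ^ p - b ^ p\<close> is \<open>a - b\<close> times a sum of
  \<open>p\<close> terms, each congruent to \<open>b ^ (p - 1)\<close> modulo \<open>p\<close>; that
  sum supplies the extra factor \<open>p\<close>.\<close>

lemma cong_prime_power_step:
  fixes a b :: int
  assumes "k > 0" and ab: "[a = b] (mod int p ^ k)"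
  shows "[a ^ p = b ^ p] (mod int p ^ Suc k)"
proof -
  have p_dvd: "int p dvd a - b"
    using ab \<open>k > 0\<close> by (meson cong_iff_dvd_diff dvd_power dvd_trans)
  then have abp: "[a = b] (mod int p)" by (simp add: cong_iff_dvd_diff)
  have "[(\<Sum>i<p. b ^ (p - Suc i) * a ^ i) = (\<Sum>i<p. b ^ (p - Suc i) * b ^ i)] (mod int p)"
    by (intro cong_sum cong_mult cong_pow abp cong_refl)
  also have "(\<Sum>i<p. b ^ (p - Suc i) * b ^ i) = (\<Sum>i<p. b ^ (p - 1))"
    by (intro sum.cong refl) (simp flip: power_add)
  also have "\<dots> = int p * b ^ (p - 1)" by simp
  finally have "int p dvd (\<Sum>i<p. b ^ (p - Suc i) * a ^ i)"
    by (metis cong_dvd_iff dvd_triv_left)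
  moreover have "int p ^ k dvd a - b" using ab by (simp add: cong_iff_dvd_diff)
  moreover have "a ^ p - b ^ p = (a - b) * (\<Sum>i<p. b ^ (p - Suc i) * a ^ i)"
    by (rule power_diff_sumr2)
  ultimately have "int p ^ k * int p dvd a ^ p - b ^ p"
    by (simp only: mult_dvd_mono)
  then show ?thesis by (simp add: cong_iff_dvd_diff mult.commute)
qed

lemma power_prime_cong:
  fixes a :: int
  assumes "prime p"
  shows "[a ^ p = a] (mod int p)"
proof -
  \<comment> \<open>The nonnegative residue of \<open>a\<close> carries Fermat's theorem over from
    the naturals to the integers.\<close>
  define b where "b = nat (a mod int p)"
  have p: "p > 0" using assms prime_gt_0_nat by blast
  have ab: "[a = int b] (mod int p)"
    unfolding b_def using p by (simp add: cong_def)
  have "[b ^ p = b] (mod p)"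
  proof (cases "p dvd b")
    case True
    then have "p dvd b ^ p" using p by (meson dvd_power dvd_trans)
    then show ?thesis using True by (metis cong_0_iff cong_sym cong_trans)
  next
    case False
    then have "[b * b ^ (p - 1) = b * 1] (mod p)"
      by (intro cong_mult cong_refl fermat_theorem assms)
    then show ?thesis using p by (simp add: power_eq_if)
  qed
  then have "[int b ^ p = int b] (mod int p)" by (metis cong_int_iff of_nat_power)
  then show ?thesis using ab by (meson cong_pow cong_sym cong_trans)
qed

text \<open>A form of Euler's congruence that also covers \<open>a\<close> divisible by
  \<open>p\<close>: starting from Fermat, each further \<open>p\<close>-th power gains one factor
  \<open>p\<close>.\<close>

lemma power_prime_power_cong:
  fixes a :: int
  assumes "prime p"
  shows "[a ^ (p ^ Suc j) = a ^ (p ^ j)] (mod int p ^ Suc j)"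
proof (induction j)
  case 0
  then show ?case using power_prime_cong[OF assms] by simp
next
  case (Suc j)
  from cong_prime_power_step[OF _ Suc] show ?case by (simp add: power_mult[symmetric] mult.commute)
qed

subsection \<open>The Moebius function\<close>

text \<open>A new prime factor raises the number of prime factors by one and creates no square prime
  divisor.\<close>

lemma moebius_prime_mult:
  assumes P: "prime P" and r: "\<not> P dvd r"
  shows "moebius (P * r) = - moebius r"
proof -
  have r0: "r \<noteq> 0" using r by (metis dvd_0_right)
  have sq: "d\<^sup>2 dvd P * r \<longleftrightarrow> d\<^sup>2 dvd r" if d: "prime d" for d
  proof
    assume dv: "d\<^sup>2 dvd P * r"
    have "d \<noteq> P" using dv r P by (auto simp: power2_eq_square)
    then have "coprime (d\<^sup>2) P" using d P by (simp add: primes_coprime)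
    then show "d\<^sup>2 dvd r" using dv by (simp add: coprime_dvd_mult_right_iff)
  qed simp
  have "prime_factors (P * r) = insert P (prime_factors r)"
    using prime_factors_product[of P r] P r0 by (auto simp: prime_prime_factors)
  moreover have "P \<notin> prime_factors r" using r by auto
  ultimately have "card (prime_factors (P * r)) = Suc (card (prime_factors r))" by simp
  then show ?thesis unfolding moebius_def using sq by (auto simp: conj_commute)
qed

text \<open>For a prime \<open>P\<close> dividing \<open>n\<close>, the divisors \<open>r\<close>
  prime to \<open>P\<close> cancel against the divisors \<open>P * r\<close>; all remaining divisors
  are multiples of the square of \<open>P\<close>, where \<open>moebius\<close> vanishes.\<close>

lemma sum_moebius_divisors:
  assumes "n > 0"
  shows "(\<Sum>r | r dvd n. moebius r) = (if n = 1 then 1 else 0)"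
proof (cases "n = 1")
  case True
  have "{r::nat. r dvd n} = {1}" using True by auto
  moreover have "moebius 1 = 1"
    unfolding moebius_def by (auto dest: prime_gt_1_nat)
  ultimately show ?thesis using True by simp
next
  case False
  then obtain P where P: "prime P" "P dvd n" using prime_factor_nat by blast
  let ?A = "{r. r dvd n \<and> \<not> P dvd r}"
  have fin: "finite {r. r dvd n}" using assms by (simp add: finite_divisors_nat)
  have finA: "finite ?A" by (rule finite_subset[OF _ fin]) auto
  have P0: "P \<noteq> 0" using P(1) by auto
  have cop: "P * r dvd n" if "r \<in> ?A" for r
    using that P by (auto intro!: divides_mult prime_imp_coprime)
  have "(\<Sum>r | r dvd n. moebius r) = (\<Sum>r \<in> ?A \<union> (*) P ` ?A. moebius r)"
  proof (rule sum.mono_neutral_right)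
    show "\<forall>r\<in>{r. r dvd n} - (?A \<union> (*) P ` ?A). moebius r = 0"
    proof
      fix r assume r: "r \<in> {r. r dvd n} - (?A \<union> (*) P ` ?A)"
      then obtain r' where r': "r = P * r'" by auto
      with r have "r' dvd n" by (auto intro: dvd_mult_right)
      with r r' have "P dvd r'" by auto
      then have "P\<^sup>2 dvd r" using r' by (simp add: power2_eq_square)
      then show "moebius r = 0" using P(1) unfolding moebius_def by auto
    qed
  qed (use fin cop in auto)
  also have "\<dots> = (\<Sum>r\<in>?A. moebius r) + (\<Sum>r\<in>(*) P ` ?A. moebius r)"
    using finA by (intro sum.union_disjoint) auto
  also have "(\<Sum>r\<in>(*) P ` ?A. moebius r) = (\<Sum>r\<in>?A. moebius (P * r))"
    using P0 by (subst sum.reindex) (auto simp: inj_on_def)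
  also have "\<dots> = (\<Sum>r\<in>?A. - moebius r)"
    using P(1) by (intro sum.cong refl moebius_prime_mult) auto
  finally show ?thesis using False by (simp add: sum_negf)
qed

text \<open>With \<open>d = t / r\<close> the double sum becomes \<open>\<Sum>\<^bsub>d | n\<^esub> F(d) \<Sum>\<^bsub>r | n/d\<^esub> \<mu>(r)\<close>, and only \<open>d = n\<close> survives.\<close>

lemma sum_moebius_chains:
  fixes F :: "nat \<Rightarrow> int"
  assumes n: "n > 0"
  shows "(\<Sum>(r, t) | r dvd t \<and> t dvd n. moebius r * F (t div r)) = F n"
proof -
  have fin: "finite {d. d dvd k}" if "k > 0" for k :: nat
    using that by (simp add: finite_divisors_nat)
  have "(\<Sum>(r, t) | r dvd t \<and> t dvd n. moebius r * F (t div r))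
      = (\<Sum>(d, r)\<in>(SIGMA d:{d. d dvd n}. {r. r dvd n div d}). F d * moebius r)"
  proof (rule sum.reindex_bij_witness[where i = "\<lambda>(d, r). (r, r * d)" and j = "\<lambda>(r, t). (t div r, r)"])
    fix a assume "a \<in> {(r, t). r dvd t \<and> t dvd n}"
    then obtain r t where a: "a = (r, t)" "r dvd t" "t dvd n" by auto
    obtain d where t: "t = r * d" using a by auto
    obtain k where k: "n = t * k" using a by auto
    have "r > 0" "d > 0" using t k n by (auto intro: Nat.gr0I)
    then show "(case case a of (r, t) \<Rightarrow> (t div r, r) of (d, r) \<Rightarrow> (r, r * d)) = a"
      "(case a of (r, t) \<Rightarrow> (t div r, r)) \<in> (SIGMA d:{d. d dvd n}. {r. r dvd n div d})"
      "(case case a of (r, t) \<Rightarrow> (t div r, r) of (d, r) \<Rightarrow> F d * moebius r)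
        = (case a of (r, t) \<Rightarrow> moebius r * F (t div r))"
      using a(1) t k by (auto simp: mult_ac)
  next
    fix b assume "b \<in> (SIGMA d:{d. d dvd n}. {r. r dvd n div d})"
    then obtain d r where b: "b = (d, r)" "d dvd n" "r dvd n div d" by auto
    obtain k where k: "n = d * k" using b by auto
    have d: "d > 0" "k > 0" using k n by (auto intro: Nat.gr0I)
    then have "r dvd k" using b k by simp
    moreover have "r > 0" using \<open>r dvd k\<close> d by (auto intro: Nat.gr0I)
    ultimately show "(case case b of (d, r) \<Rightarrow> (r, r * d) of (r, t) \<Rightarrow> (t div r, r)) = b"
      "(case b of (d, r) \<Rightarrow> (r, r * d)) \<in> {(r, t). r dvd t \<and> t dvd n}"
      using b(1) k by (auto simp: mult_ac)
  qed
  also have "\<dots> = (\<Sum>d | d dvd n. F d * (\<Sum>r | r dvd n div d. moebius r))"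
    using n by (subst sum.Sigma[symmetric])
      (auto simp: sum_distrib_left finite_divisors_nat dvd_div_eq_0_iff intro!: fin Nat.gr0I)
  also have "\<dots> = (\<Sum>d | d dvd n. if d = n then F d else 0)"
  proof (intro sum.cong refl)
    fix d assume "d \<in> {d. d dvd n}"
    then obtain k where k: "n = d * k" by auto
    have "d > 0" "k > 0" using k n by (auto intro: Nat.gr0I)
    then show "F d * (\<Sum>r | r dvd n div d. moebius r) = (if d = n then F d else 0)"
      using k sum_moebius_divisors[of k] by auto
  qed
  also have "\<dots> = F n" using fin[OF n] by simp
  finally show ?thesis .
qed

subsection \<open>Sums over orbits and rotations of words\<close>

text \<open>\<open>A\<close> splits into orbits of \<open>\<rho>\<close> on which \<open>f\<close>
  is constant, and an orbit of length \<open>d\<close> contributes \<open>d * f x\<close>. The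
  induction removes one orbit at a time.\<close>

lemma dvd_sum_of_orbits:
  fixes f :: "'a \<Rightarrow> int"
  assumes "finite A" and N: "N > 0"
    and "\<And>x. x \<in> A \<Longrightarrow> \<rho> x \<in> A"
    and "\<And>x. x \<in> A \<Longrightarrow> (\<rho> ^^ N) x = x"
    and "\<And>x. x \<in> A \<Longrightarrow> f (\<rho> x) = f x"
    and "\<And>x d. x \<in> A \<Longrightarrow> d dvd N \<Longrightarrow> (\<rho> ^^ d) x = x \<Longrightarrow> M dvd int d * f x"
  shows "M dvd (\<Sum>x\<in>A. f x)"
  using assms(1,3-)
proof (induction A rule: finite_psubset_induct)
  case (psubset A)
  show ?case
  proof (cases "A = {}")
    case False
    then obtain x where x: "x \<in> A" by auto
    \<comment> \<open>The least positive period of \<open>x\<close> is the length of its orbit; by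
      minimality \<open>N mod d\<close> is zero, so it divides \<open>N\<close>.\<close>
    define d where "d = (LEAST d. d > 0 \<and> (\<rho> ^^ d) x = x)"
    have dN: "d > 0 \<and> (\<rho> ^^ d) x = x"
      unfolding d_def by (rule LeastI[of _ N]) (use N psubset.prems(2)[OF x] in auto)
    have least: "(\<rho> ^^ k) x \<noteq> x" if "0 < k" "k < d" for k
      using not_less_Least[of k "\<lambda>d. d > 0 \<and> (\<rho> ^^ d) x = x"] that d_def by auto
    have mod_d: "(\<rho> ^^ (k mod d)) x = (\<rho> ^^ k) x" for k
      using dN by (intro funpow_mod_eq) auto
    have d_dvd: "d dvd N"
    proof (rule ccontr)
      assume "\<not> d dvd N"
      then have "0 < N mod d" by (simp add: dvd_eq_mod_eq_0)
      then show False using least[of "N mod d"] mod_d[of N] psubset.prems(2)[OF x] dN by simp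
    qed
    define orb where "orb = (\<lambda>k. (\<rho> ^^ k) x) ` {..<d}"
    have in_orb: "(\<rho> ^^ k) x \<in> orb" for k
      unfolding orb_def using mod_d[of k] dN by (intro image_eqI[of _ _ "k mod d"]) auto
    have in_A: "(\<rho> ^^ k) x \<in> A" for k by (induction k) (auto simp: x psubset.prems(1))
    have f_orb: "f ((\<rho> ^^ k) x) = f x" for k
      by (induction k) (auto simp: in_A psubset.prems(3))
    have inj: "inj_on (\<lambda>k. (\<rho> ^^ k) x) {..<d}"
    proof (rule linorder_inj_onI)
      fix i j assume ij: "i < j" "i \<in> {..<d}" "j \<in> {..<d}"
      show "(\<rho> ^^ i) x \<noteq> (\<rho> ^^ j) x"
      proof
        assume "(\<rho> ^^ i) x = (\<rho> ^^ j) x"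
        then have "(\<rho> ^^ (d - j)) ((\<rho> ^^ i) x) = (\<rho> ^^ (d - j)) ((\<rho> ^^ j) x)" by simp
        then have "(\<rho> ^^ (d - j + i)) x = (\<rho> ^^ (d - j + j)) x" by (simp only: funpow_add o_apply)
        moreover have "d - j + j = d" "0 < d - j + i" "d - j + i < d" using ij by auto
        ultimately show False using least dN by metis
      qed
    qed auto
    have sub: "orb \<subseteq> A" unfolding orb_def using in_A by auto
    have "(\<Sum>y\<in>orb. f y) = int d * f x"
      unfolding orb_def using inj by (simp add: sum.reindex f_orb)
    then have "M dvd (\<Sum>y\<in>orb. f y)" using psubset.prems(4)[OF x d_dvd] dN by simp
    moreover have "M dvd (\<Sum>y\<in>A - orb. f y)"
    proof (rule psubset.IH)
      show "A - orb \<subset> A" using x in_orb[of 0] by auto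
      fix y assume y: "y \<in> A - orb"
      show "\<rho> y \<in> A - orb"
      proof
        show "\<rho> y \<in> A" using y psubset.prems(1) by auto
        show "\<rho> y \<notin> orb"
        proof
          assume "\<rho> y \<in> orb"
          then obtain k where "\<rho> y = (\<rho> ^^ k) x" unfolding orb_def by auto
          \<comment> \<open>On \<open>A\<close> the power \<open>\<rho> ^^ (N - 1)\<close> undoes
            \<open>\<rho>\<close>, so \<open>y\<close> would lie in the orbit together with its
            image.\<close>
          then have "(\<rho> ^^ (N - 1 + k)) x = (\<rho> ^^ (N - 1)) (\<rho> y)" by (simp add: funpow_add)
          also have "\<dots> = (\<rho> ^^ N) y" using N by (cases N) (simp_all add: funpow_swap1)
          also have "\<dots> = y" using y psubset.prems(2) by auto
          finally show False using y in_orb by force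
        qed
      qed
    qed (use psubset.prems in auto)
    moreover have "(\<Sum>y\<in>A. f y) = (\<Sum>y\<in>A - orb. f y) + (\<Sum>y\<in>orb. f y)"
      using sub psubset.hyps by (intro sum.subset_diff) auto
    ultimately show ?thesis by simp
  qed simp
qed

text \<open>Split off the first block \<open>a\<close> of length \<open>d\<close>. Invariance says
  that \<open>a\<close> commutes with the rest \<open>b\<close> under concatenation, so a nonempty
  \<open>b\<close> begins with \<open>a\<close> and is again fixed by the rotation.\<close>

lemma rotate_fixed_imp_power:
  "rotate d xs = xs \<Longrightarrow> length xs = k * d \<Longrightarrow> xs = concat (replicate k (take d xs))"
proof (induction k arbitrary: xs)
  case (Suc k)
  define a b where "a = take d xs" and "b = drop d xs"
  have len: "length a = d" "length b = k * d" using Suc.prems by (auto simp: a_def b_def)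
  have xs: "xs = a @ b" by (simp add: a_def b_def)
  have ab: "b @ a = a @ b"
    using Suc.prems(1) rotate_append[of a b] xs len(1) by metis
  show ?case
  proof (cases k)
    case 0
    then show ?thesis using len xs by simp
  next
    case (Suc k')
    then have "d \<le> length b" using len by simp
    then have a: "take d b = a"
      using arg_cong[OF ab, of "take d"] len by simp
    define c where "c = drop d b"
    have b: "b = a @ c" using a append_take_drop_id[of d b] by (simp add: c_def)
    have "c @ a = a @ c" using ab unfolding b by simp
    then have "rotate d b = b" unfolding b using len by (metis rotate_append)
    from Suc.IH[OF this len(2)] have "b = concat (replicate k a)" using a by simp
    then show ?thesis using xs len by simp
  qed
qed simp

lemma rotate_concat_replicate: "rotate (length xs) (concat (replicate k xs)) = concat (replicate k xs)"
proof (cases k)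
  case (Suc j)
  have "concat (replicate j xs) @ xs = xs @ concat (replicate j xs)"
    by (induction j) auto
  then show ?thesis using Suc by (simp add: rotate_append)
qed simp

text \<open>With \<open>K\<close> the support of \<open>u\<close>, these words index the terms in
  the expansion of the \<open>N\<close>-th power of \<open>u\<close>.\<close>

definition words :: "'a set \<Rightarrow> nat \<Rightarrow> 'a list set" where
  "words K N = {xs. set xs \<subseteq> K \<and> length xs = N}"

lemma finite_words: "finite K \<Longrightarrow> finite (words K N)"
  unfolding words_def by (rule finite_lists_length_eq)

lemma words_0: "words K 0 = {[]}"
  unfolding words_def by auto

lemma sum_words_Suc:
  assumes "finite K"
  shows "(\<Sum>xs\<in>words K (Suc N). f xs) = (\<Sum>x\<in>K. \<Sum>xs\<in>words K N. f (x # xs))"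
proof -
  have "(\<Sum>x\<in>K. \<Sum>xs\<in>words K N. f (x # xs)) = (\<Sum>(x, xs)\<in>K \<times> words K N. f (x # xs))"
    by (simp add: sum.cartesian_product)
  also have "\<dots> = (\<Sum>xs\<in>words K (Suc N). f xs)"
    by (rule sum.reindex_bij_witness[where i = "\<lambda>xs. (hd xs, tl xs)" and j = "\<lambda>(x, xs). x # xs"])
      (auto simp: words_def length_Suc_conv)
  finally show ?thesis by simp
qed

text \<open>The fixed words are exactly the \<open>k\<close>-th powers: taking the first
  \<open>N\<close> letters inverts \<open>k\<close>-fold repetition.\<close>

lemma sum_words_fixed:
  assumes "k > 0"
  shows "(\<Sum>xs\<in>{xs \<in> words K (k * N). rotate N xs = xs}. f xs)
    = (\<Sum>xs\<in>words K N. f (concat (replicate k xs)))"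
proof (rule sum.reindex_bij_witness[where i = "\<lambda>xs. concat (replicate k xs)" and j = "take N"])
  fix xs assume "xs \<in> {xs \<in> words K (k * N). rotate N xs = xs}"
  then have xs: "set xs \<subseteq> K" "length xs = k * N" "rotate N xs = xs" by (auto simp: words_def)
  from rotate_fixed_imp_power[OF xs(3,2)]
  show eq: "concat (replicate k (take N xs)) = xs" by simp
  show "take N xs \<in> words K N"
    using xs assms set_take_subset[of N xs] by (auto simp: words_def)
  show "f (concat (replicate k (take N xs))) = f xs" by (simp add: eq)
next
  fix xs assume xs: "xs \<in> words K N"
  then show "take N (concat (replicate k xs)) = xs"
    using assms by (cases k) (auto simp: words_def)
  show "concat (replicate k xs) \<in> {xs \<in> words K (k * N). rotate N xs = xs}"
    using xs rotate_concat_replicate[of xs k] by (auto simp: words_def length_concat sum_list_replicate)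
qed

subsection \<open>Linearity of partial augmentations\<close>

text \<open>Indicator weights over a common finite set make augmentations of elements with different
  supports comparable. An arbitrary property \<open>P\<close> is allowed because the preimage of a
  class under a power map need not be a single class.\<close>

lemma class_aug_superset:
  fixes w :: "'g \<Rightarrow>\<^sub>0 'r::comm_ring_1"
  assumes "finite A" "Poly_Mapping.keys w \<subseteq> A"
  shows "class_aug w {g. P g} = (\<Sum>g\<in>A. of_bool (P g) * Poly_Mapping.lookup w g)"
proof -
  have "(\<Sum>g\<in>A. of_bool (P g) * Poly_Mapping.lookup w g)
      = (\<Sum>g\<in>{g. P g} \<inter> Poly_Mapping.keys w. of_bool (P g) * Poly_Mapping.lookup w g)"
    using assms by (intro sum.mono_neutral_right) (auto simp: in_keys_iff)
  also have "\<dots> = class_aug w {g. P g}"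
    unfolding class_aug_def by (intro sum.cong) auto
  finally show ?thesis by simp
qed

lemmas class_aug_keys = class_aug_superset[OF finite_keys order_refl]

lemma class_aug_cong:
  assumes "\<And>g. g \<in> Poly_Mapping.keys w \<Longrightarrow> P g \<longleftrightarrow> Q g"
  shows "class_aug w {g. P g} = class_aug w {g. Q g}"
  unfolding class_aug_def using assms by (intro sum.cong) auto

lemma class_aug_zero: "class_aug 0 X = 0"
  by (simp add: class_aug_def)

lemma class_aug_add:
  fixes v w :: "'g \<Rightarrow>\<^sub>0 'r::comm_ring_1"
  shows "class_aug (v + w) {g. P g} = class_aug v {g. P g} + class_aug w {g. P g}"
proof -
  let ?A = "Poly_Mapping.keys v \<union> Poly_Mapping.keys w"
  have "finite ?A" "Poly_Mapping.keys (v + w) \<subseteq> ?A" "Poly_Mapping.keys v \<subseteq> ?A"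
    "Poly_Mapping.keys w \<subseteq> ?A"
    using Poly_Mapping.keys_add[of v w] by auto
  then show ?thesis
    by (simp add: class_aug_superset[of ?A] lookup_add distrib_left sum.distrib)
qed

lemma class_aug_sum:
  fixes w :: "'i \<Rightarrow> 'g \<Rightarrow>\<^sub>0 'r::comm_ring_1"
  shows "class_aug (\<Sum>i\<in>I. w i) {g. P g} = (\<Sum>i\<in>I. class_aug (w i) {g. P g})"
  by (induction I rule: infinite_finite_induct) (simp_all add: class_aug_zero class_aug_add)

lemma class_aug_single:
  fixes a :: "'r::comm_ring_1"
  shows "class_aug (Poly_Mapping.single g a) {g. P g} = of_bool (P g) * a"
  by (subst class_aug_superset[of "{g}"]) auto

lemma class_aug_convolution:
  fixes v w :: "'g \<Rightarrow>\<^sub>0 'r::comm_ring_1"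
  shows "class_aug (convolution G v w) {g. P g} =
    (\<Sum>x\<in>Poly_Mapping.keys v. \<Sum>y\<in>Poly_Mapping.keys w.
       of_bool (P (x \<otimes>\<^bsub>G\<^esub> y)) * (Poly_Mapping.lookup v x * Poly_Mapping.lookup w y))"
  by (simp add: convolution_def class_aug_sum class_aug_single)

lemma class_aug_scaled:
  fixes v w :: "'g \<Rightarrow>\<^sub>0 'r::comm_ring_1"
  assumes "\<And>g. Poly_Mapping.lookup v g = c * Poly_Mapping.lookup w g"
  shows "class_aug v {g. P g} = c * class_aug w {g. P g}"
proof -
  have "Poly_Mapping.keys v \<subseteq> Poly_Mapping.keys w" using assms by (auto simp: in_keys_iff)
  then show ?thesis
    using assms
    by (simp add: class_aug_superset[of "Poly_Mapping.keys w"] sum_distrib_left mult_ac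
        del: sum_of_bool_mult_eq sum_mult_of_bool_eq)
qed

text \<open>From \<open>u = \<beta> e\<close> follows \<open>u^2 = \<beta>^2 e = \<beta> u\<close>.
  The coefficients are compared in the rationals, where those of \<open>e\<close> live, and pulled
  back to the integers.\<close>

lemma convolution_scaled_idempotent:
  fixes e :: "'g \<Rightarrow>\<^sub>0 rat" and u :: "'g \<Rightarrow>\<^sub>0 int"
  assumes e: "convolution G e e = e"
    and u: "\<And>g. of_int (Poly_Mapping.lookup u g) = of_int \<beta> * Poly_Mapping.lookup e g"
  shows "Poly_Mapping.lookup (convolution G u u) g = \<beta> * Poly_Mapping.lookup u g"
proof -
  let ?A = "Poly_Mapping.keys u \<union> Poly_Mapping.keys e"
  have A: "finite ?A" "Poly_Mapping.keys u \<subseteq> ?A" "Poly_Mapping.keys e \<subseteq> ?A" by auto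
  have "(of_int (Poly_Mapping.lookup (convolution G u u) g) :: rat) =
      (\<Sum>x\<in>?A. \<Sum>y\<in>?A. of_bool (x \<otimes>\<^bsub>G\<^esub> y = g)
        * (of_int (Poly_Mapping.lookup u x) * of_int (Poly_Mapping.lookup u y)))"
    unfolding convolution_superset[OF A(1,2) A(1,2)] lookup_sum of_int_sum
    by (intro sum.cong refl) (simp add: lookup_single when_def)
  also have "\<dots> = of_int \<beta> * of_int \<beta> * (\<Sum>x\<in>?A. \<Sum>y\<in>?A. of_bool (x \<otimes>\<^bsub>G\<^esub> y = g)
        * (Poly_Mapping.lookup e x * Poly_Mapping.lookup e y))"
    unfolding u sum_distrib_left by (intro sum.cong refl) (simp add: mult_ac)
  also have "(\<Sum>x\<in>?A. \<Sum>y\<in>?A. of_bool (x \<otimes>\<^bsub>G\<^esub> y = g)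
        * (Poly_Mapping.lookup e x * Poly_Mapping.lookup e y)) = Poly_Mapping.lookup (convolution G e e) g"
    unfolding convolution_superset[OF A(1,3) A(1,3)] lookup_sum
    by (intro sum.cong refl) (simp add: lookup_single when_def)
  also have "of_int \<beta> * of_int \<beta> * Poly_Mapping.lookup (convolution G e e) g
      = of_int (\<beta> * Poly_Mapping.lookup u g)"
    by (simp add: e u)
  finally show ?thesis by (simp only: of_int_eq_iff)
qed

subsection \<open>Class predicates and products of words\<close>

text \<open>One implication is enough for invariance: conjugating by the inverse gives the
  converse.\<close>

definition class_pred :: "('g, 'm) monoid_scheme \<Rightarrow> ('g \<Rightarrow> bool) \<Rightarrow> bool" where
  "class_pred G P \<longleftrightarrow>
     (\<forall>g\<in>carrier G. \<forall>x\<in>carrier G. P x \<longrightarrow> P (g \<otimes>\<^bsub>G\<^esub> x \<otimes>\<^bsub>G\<^esub> inv\<^bsub>G\<^esub> g))"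

definition word_prod :: "('g, 'm) monoid_scheme \<Rightarrow> 'g list \<Rightarrow> 'g" where
  "word_prod G xs = foldr (\<otimes>\<^bsub>G\<^esub>) xs \<one>\<^bsub>G\<^esub>"

definition word_coeff :: "('g \<Rightarrow>\<^sub>0 'r::comm_ring_1) \<Rightarrow> 'g list \<Rightarrow> 'r" where
  "word_coeff u xs = (\<Prod>x\<leftarrow>xs. Poly_Mapping.lookup u x)"

lemma word_coeff_append: "word_coeff u (xs @ ys) = word_coeff u xs * word_coeff u ys"
  by (simp add: word_coeff_def)

lemma word_coeff_replicate: "word_coeff u (concat (replicate k xs)) = word_coeff u xs ^ k"
  by (induction k) (simp_all add: word_coeff_append, simp add: word_coeff_def)

lemma word_coeff_rotate1: "word_coeff u (rotate1 xs) = word_coeff u xs"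
  by (cases xs) (simp_all add: word_coeff_def mult.commute)

context group
begin

lemma conj_pow:
  assumes "g \<in> carrier G" "x \<in> carrier G"
  shows "(g \<otimes> x \<otimes> inv g) [^] (k::nat) = g \<otimes> x [^] k \<otimes> inv g"
proof (induction k)
  case (Suc k)
  have "inv g \<otimes> (g \<otimes> (x \<otimes> inv g)) = x \<otimes> inv g"
    using assms by (simp flip: m_assoc)
  then show ?case using assms Suc by (simp add: m_assoc)
qed (use assms in simp)

text \<open>Powers commute with conjugation. This keeps the predicate admissible when the power map
  is iterated.\<close>

lemma class_pred_pow:
  assumes "class_pred G P"
  shows "class_pred G (\<lambda>x. P (x [^] (k::nat)))"
  using assms unfolding class_pred_def by (auto simp: conj_pow)

text \<open>Conjugating \<open>y \<otimes> x\<close> by \<open>x\<close> gives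
  \<open>x \<otimes> y\<close>.\<close>

lemma class_pred_comm:
  assumes P: "class_pred G P" and "x \<in> carrier G" "y \<in> carrier G"
  shows "P (x \<otimes> y) \<longleftrightarrow> P (y \<otimes> x)"
proof -
  have "P (b \<otimes> a) \<Longrightarrow> P (a \<otimes> b)" if "a \<in> carrier G" "b \<in> carrier G" for a b
  proof -
    assume "P (b \<otimes> a)"
    then have "P (a \<otimes> (b \<otimes> a) \<otimes> inv a)" using P that unfolding class_pred_def by auto
    then show ?thesis using that by (simp add: m_assoc)
  qed
  then show ?thesis using assms by blast
qed

lemma class_pred_conj_class:
  assumes "class_pred G P" "x \<in> carrier G" "y \<in> conj_class G x"
  shows "P y \<longleftrightarrow> P x"
proof -
  have sub: "P b" if "P a" "a \<in> carrier G" "b \<in> conj_class G a" for a b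
    using that assms(1) unfolding class_pred_def conj_class_def by auto
  have y: "y \<in> carrier G" using assms(2,3) by (auto simp: conj_class_def)
  have "x \<in> conj_class G y" using conj_class_eq[OF assms(2,3)] conj_class_self[OF assms(2)] by simp
  then show ?thesis using sub assms y by blast
qed

lemma class_pred_in_conj_class:
  assumes "s \<in> carrier G"
  shows "class_pred G (\<lambda>x. x \<in> conj_class G s)"
  unfolding class_pred_def
proof (intro ballI impI)
  fix g x assume "g \<in> carrier G" "x \<in> carrier G" "x \<in> conj_class G s"
  then have "g \<otimes> x \<otimes> inv g \<in> conj_class G x" by (auto simp: conj_class_def)
  then show "g \<otimes> x \<otimes> inv g \<in> conj_class G s"
    using conj_class_eq[OF assms \<open>x \<in> conj_class G s\<close>] by simp
qed

lemma class_pred_is_power: "class_pred G (\<lambda>x. \<exists>y\<in>carrier G. y [^] (k::nat) = x)"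
  unfolding class_pred_def
proof (intro ballI impI)
  fix g x assume g: "g \<in> carrier G" and "\<exists>y\<in>carrier G. y [^] k = x"
  then obtain y where y: "y \<in> carrier G" "y [^] k = x" by auto
  show "\<exists>y\<in>carrier G. y [^] k = g \<otimes> x \<otimes> inv g"
    using g y by (intro bexI[of _ "g \<otimes> y \<otimes> inv g"]) (auto simp: conj_pow)
qed

lemma word_prod_closed: "set xs \<subseteq> carrier G \<Longrightarrow> word_prod G xs \<in> carrier G"
  by (induction xs) (auto simp: word_prod_def)

lemma word_prod_append:
  "set xs \<subseteq> carrier G \<Longrightarrow> set ys \<subseteq> carrier G \<Longrightarrow>
    word_prod G (xs @ ys) = word_prod G xs \<otimes> word_prod G ys"
proof (induction xs)
  case (Cons x xs)
  then show ?case
    using word_prod_closed[of xs] word_prod_closed[of ys] by (simp add: word_prod_def m_assoc)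
qed (use word_prod_closed[of ys] in \<open>simp add: word_prod_def\<close>)

lemma word_prod_replicate:
  assumes "set xs \<subseteq> carrier G"
  shows "word_prod G (concat (replicate k xs)) = word_prod G xs [^] k"
proof (induction k)
  case (Suc k)
  have "set (concat (replicate k xs)) \<subseteq> carrier G" using assms by auto
  then have "word_prod G (concat (replicate (Suc k) xs)) = word_prod G xs \<otimes> word_prod G xs [^] k"
    using assms Suc by (simp add: word_prod_append)
  then show ?case by (simp only: nat_pow_Suc2[OF word_prod_closed[OF assms]])
qed (simp add: word_prod_def)

text \<open>Moving the first letter to the end conjugates the product.\<close>

lemma class_pred_rotate1:
  assumes "class_pred G P" "set xs \<subseteq> carrier G"
  shows "P (word_prod G (rotate1 xs)) \<longleftrightarrow> P (word_prod G xs)"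
proof (cases xs)
  case (Cons x ys)
  have x: "word_prod G [x] = x" using assms Cons by (simp add: word_prod_def)
  have "word_prod G xs = x \<otimes> word_prod G ys" by (simp add: Cons word_prod_def)
  moreover have "word_prod G (rotate1 xs) = word_prod G ys \<otimes> x"
    using assms Cons by (simp add: word_prod_append x)
  ultimately show ?thesis
    using class_pred_comm[OF assms(1)] word_prod_closed[of ys] assms(2) Cons by auto
qed simp

subsection \<open>Power maps and multiples of idempotents\<close>

text \<open>Both sides are the sum of the coefficients of \<open>u^(N+1) = \<beta>^N u\<close> over the elements satisfying \<open>P\<close>.\<close>

lemma sum_words_scaled_idempotent:
  fixes u :: "'a \<Rightarrow>\<^sub>0 'r::comm_ring_1"
  assumes u: "Poly_Mapping.keys u \<subseteq> carrier G"
    and uu: "\<And>g. Poly_Mapping.lookup (convolution G u u) g = \<beta> * Poly_Mapping.lookup u g"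
  shows "(\<Sum>xs\<in>words (Poly_Mapping.keys u) (Suc N). of_bool (P (word_prod G xs)) * word_coeff u xs)
    = \<beta> ^ N * class_aug u {g. P g}"
proof (induction N arbitrary: P)
  case 0
  have "(\<Sum>xs\<in>words (Poly_Mapping.keys u) (Suc 0). of_bool (P (word_prod G xs)) * word_coeff u xs)
      = (\<Sum>x\<in>Poly_Mapping.keys u. of_bool (P (x \<otimes> \<one>)) * Poly_Mapping.lookup u x)"
    by (simp add: sum_words_Suc words_0 word_prod_def word_coeff_def)
  also have "\<dots> = class_aug u {g. P g}"
    unfolding class_aug_keys using u by (intro sum.cong refl) auto
  finally show ?case by simp
next
  case (Suc N)
  let ?K = "Poly_Mapping.keys u"
  have "(\<Sum>xs\<in>words ?K (Suc (Suc N)). of_bool (P (word_prod G xs)) * word_coeff u xs)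
      = (\<Sum>x\<in>?K. Poly_Mapping.lookup u x *
          (\<Sum>xs\<in>words ?K (Suc N). of_bool (P (x \<otimes> word_prod G xs)) * word_coeff u xs))"
    by (subst sum_words_Suc) (simp_all add: word_prod_def word_coeff_def sum_distrib_left mult_ac)
  \<comment> \<open>The translated predicate need not be conjugation invariant, so the induction
    runs over arbitrary \<open>P\<close>.\<close>
  also have "\<dots> = (\<Sum>x\<in>?K. Poly_Mapping.lookup u x * (\<beta> ^ N * class_aug u {g. P (x \<otimes> g)}))"
    by (simp only: Suc.IH[of "\<lambda>g. P (_ \<otimes> g)"])
  also have "\<dots> = \<beta> ^ N * class_aug (convolution G u u) {g. P g}"
    unfolding class_aug_convolution class_aug_keys[of u] sum_distrib_left
    by (intro sum.cong refl) (simp add: mult_ac)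
  also have "\<dots> = \<beta> ^ Suc N * class_aug u {g. P g}"
    using class_aug_scaled[of "convolution G u u" \<beta> u P] uu by (simp add: mult_ac)
  finally show ?case .
qed

text \<open>Words not fixed by rotation through \<open>p^n\<close> places cancel modulo
  \<open>p^(n+1)\<close>. The fixed ones are \<open>p\<close>-th powers of shorter words with
  coefficient \<open>a\<close>, and contribute \<open>a^p\<close>; a second orbit argument replaces
  \<open>a^p\<close> by \<open>a\<close>.\<close>

lemma sum_words_prime_power_cong:
  fixes u :: "'a \<Rightarrow>\<^sub>0 int"
  assumes p: "prime p" and K: "finite K" "K \<subseteq> carrier G" and P: "class_pred G P"
  shows "[(\<Sum>xs\<in>words K (p ^ Suc n). of_bool (P (word_prod G xs)) * word_coeff u xs)
    = (\<Sum>xs\<in>words K (p ^ n). of_bool (P (word_prod G xs [^] p)) * word_coeff u xs)]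
      (mod int p ^ Suc n)"
proof -
  define f where "f xs = of_bool (P (word_prod G xs)) * word_coeff u xs" for xs
  \<comment> \<open>\<open>h\<close> is the error made by replacing the coefficient of the
    \<open>p\<close>-th power of a word by that of the word itself.\<close>
  define h where "h xs = of_bool (P (word_prod G xs [^] p)) * (word_coeff u xs ^ p - word_coeff u xs)" for xs
  define N where "N = p ^ n"
  have p0: "p > 0" using p prime_gt_0_nat by blast
  then have N0: "N > 0" by (simp add: N_def)
  have words_carrier: "set xs \<subseteq> carrier G" if "xs \<in> words K l" for xs l
    using that K by (auto simp: words_def)
  have rotate1_words: "rotate1 xs \<in> words K l" if "xs \<in> words K l" for xs l
    using that by (auto simp: words_def)
  have rotate_full: "(rotate1 ^^ l) xs = xs" if "xs \<in> words K l" for xs l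
    using that by (auto simp: words_def rotate_def[symmetric] rotate_id)
  have f_rotate1: "f (rotate1 xs) = f xs" if "xs \<in> words K l" for xs l
    using class_pred_rotate1[OF P words_carrier[OF that]] by (simp add: f_def word_coeff_rotate1)
  have h_rotate1: "h (rotate1 xs) = h xs" if "xs \<in> words K l" for xs l
    using class_pred_rotate1[OF class_pred_pow[OF P] words_carrier[OF that]]
    by (simp add: h_def word_coeff_rotate1)

  text \<open>A word not fixed by rotation through \<open>p^n\<close> places has a full orbit of \<open>p^(n+1)\<close> rotations.\<close>
  have 1: "int p ^ Suc n dvd (\<Sum>xs\<in>words K (p * N). if rotate N xs = xs then 0 else f xs)"
  proof (rule dvd_sum_of_orbits[where \<rho> = rotate1 and N = "p * N"])
    show "(if rotate N (rotate1 xs) = rotate1 xs then 0 else f (rotate1 xs))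
        = (if rotate N xs = xs then 0 else f xs)" if "xs \<in> words K (p * N)" for xs
    proof -
      have "rotate N (rotate1 xs) = rotate1 xs \<longleftrightarrow> rotate1 (rotate N xs) = rotate1 xs"
        by (simp add: rotate1_rotate_swap)
      also have "\<dots> \<longleftrightarrow> rotate N xs = xs" by (metis injD inj_rotate1)
      finally show ?thesis using f_rotate1[OF that] by simp
    qed
    fix xs d assume xs: "xs \<in> words K (p * N)" and d: "d dvd p * N" "(rotate1 ^^ d) xs = xs"
    obtain i where i: "d = p ^ i" "i \<le> Suc n"
      using d(1) divides_primepow_nat[OF p, of d "Suc n"] by (auto simp: N_def)
    show "int p ^ Suc n dvd int d * (if rotate N xs = xs then 0 else f xs)"
    proof (cases "i = Suc n")
      case True
      then show ?thesis using i by simp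
    next
      case False
      then have "d dvd N" using i unfolding N_def by (simp add: le_imp_power_dvd)
      then obtain k where k: "N = d * k" by auto
      have "((rotate1 ^^ d) ^^ k) xs = xs" using d(2) by (induction k) auto
      then have "rotate N xs = xs" by (simp add: k rotate_def funpow_mult)
      then show ?thesis by simp
    qed
  qed (use K p0 N0 finite_words rotate1_words rotate_full in auto)

  text \<open>A word with \<open>p^i\<close> rotations is a \<open>p^(n-i)\<close>-th power, so its coefficient \<open>a\<close> satisfies \<open>a^p \<equiv> a\<close> modulo \<open>p^(n-i+1)\<close>.\<close>
  have 2: "int p ^ Suc n dvd (\<Sum>xs\<in>words K N. h xs)"
  proof (rule dvd_sum_of_orbits[where \<rho> = rotate1 and N = N])
    fix xs d assume xs: "xs \<in> words K N" and d: "d dvd N" "(rotate1 ^^ d) xs = xs"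
    obtain i where i: "d = p ^ i" "i \<le> n"
      using d(1) divides_primepow_nat[OF p, of d n] by (auto simp: N_def)
    have "length xs = p ^ (n - i) * d"
      using xs i by (simp add: words_def N_def flip: power_add)
    with d(2) have "xs = concat (replicate (p ^ (n - i)) (take d xs))"
      by (intro rotate_fixed_imp_power) (simp_all add: rotate_def)
    then have "word_coeff u xs = word_coeff u (take d xs) ^ (p ^ (n - i))"
      by (metis word_coeff_replicate)
    then have "int p ^ Suc (n - i) dvd word_coeff u xs ^ p - word_coeff u xs"
      using power_prime_power_cong[OF p, of "word_coeff u (take d xs)" "n - i"]
      by (simp add: cong_iff_dvd_diff power_mult[symmetric] mult.commute)
    then have "int p ^ i * int p ^ Suc (n - i) dvd int d * h xs"
      unfolding h_def i(1) by (simp add: mult_dvd_mono)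
    moreover have "int p ^ i * int p ^ Suc (n - i) = int p ^ Suc n"
      using i(2) by (simp flip: power_add)
    ultimately show "int p ^ Suc n dvd int d * h xs" by (simp only:)
  qed (use K N0 finite_words rotate1_words rotate_full h_rotate1 in auto)

  have "(\<Sum>xs\<in>words K (p * N). f xs)
      = (\<Sum>xs\<in>words K (p * N). (if rotate N xs = xs then 0 else f xs)
          + (if rotate N xs = xs then f xs else 0))"
    by (intro sum.cong) auto
  also have "\<dots> = (\<Sum>xs\<in>words K (p * N). if rotate N xs = xs then 0 else f xs)
      + (\<Sum>xs\<in>{xs \<in> words K (p * N). rotate N xs = xs}. f xs)"
    using finite_words[OF K(1)] by (simp add: sum.distrib sum.inter_filter)
  also have "(\<Sum>xs\<in>{xs \<in> words K (p * N). rotate N xs = xs}. f xs)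
      = (\<Sum>xs\<in>words K N. f (concat (replicate p xs)))"
    by (rule sum_words_fixed[OF p0])
  also have "\<dots> = (\<Sum>xs\<in>words K N. h xs)
      + (\<Sum>xs\<in>words K N. of_bool (P (word_prod G xs [^] p)) * word_coeff u xs)"
    unfolding sum.distrib[symmetric] f_def h_def
    using words_carrier by (intro sum.cong refl)
      (simp add: word_prod_replicate word_coeff_replicate algebra_simps)
  finally show ?thesis using 1 2 unfolding f_def N_def cong_iff_dvd_diff
    by (simp add: algebra_simps)
qed

text \<open>
  Since \<open>\<beta>^(p^(n+1))\<close> and \<open>\<beta>^(p^n)\<close> agree modulo \<open>p^(n+1)\<close>, the previous lemma makes the two sides
  congruent modulo every power of \<open>p\<close>.
\<close>

lemma class_aug_prime_power_map:
  fixes u :: "'a \<Rightarrow>\<^sub>0 int"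
  assumes u: "Poly_Mapping.keys u \<subseteq> carrier G"
    and uu: "\<And>g. Poly_Mapping.lookup (convolution G u u) g = \<beta> * Poly_Mapping.lookup u g"
    and p: "prime p" "\<not> int p dvd \<beta>" and P: "class_pred G P"
  shows "class_aug u {g. P g} = class_aug u {g. P (g [^] p)}" (is "?a = ?b")
proof -
  have p0: "p > 1" using p(1) prime_gt_1_nat by blast
  \<comment> \<open>Words of length \<open>l\<close> yield only \<open>\<beta> ^ (l - 1)\<close>;
    the extra factor \<open>\<beta>\<close> makes the exponents the powers of \<open>p\<close> to
    which \<open>power_prime_power_cong\<close> applies.\<close>
  have words_sum: "\<beta> * (\<Sum>xs\<in>words (Poly_Mapping.keys u) l. of_bool (Q (word_prod G xs)) * word_coeff u xs)
      = \<beta> ^ l * class_aug u {g. Q g}" if "l > 0" for l Q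
    using that sum_words_scaled_idempotent[OF u uu, where P = Q and N = "l - 1"]
    by (cases l) (simp_all add: mult_ac)
  have "int p ^ Suc n dvd ?a - ?b" for n
  proof -
    have "[\<beta> ^ (p ^ Suc n) * ?a = \<beta> ^ (p ^ n) * ?b] (mod int p ^ Suc n)"
      using cong_mult[OF cong_refl[of \<beta>] sum_words_prime_power_cong[OF p(1) finite_keys u P, of u n]]
      using words_sum[of "p ^ Suc n" P] words_sum[of "p ^ n" "\<lambda>g. P (g [^] p)"] p0
      by simp
    moreover have "[\<beta> ^ (p ^ Suc n) * ?a = \<beta> ^ (p ^ n) * ?a] (mod int p ^ Suc n)"
      by (intro cong_mult cong_refl power_prime_power_cong p(1))
    ultimately have "[\<beta> ^ (p ^ n) * ?a = \<beta> ^ (p ^ n) * ?b] (mod int p ^ Suc n)"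
      by (meson cong_sym cong_trans)
    moreover have "coprime (\<beta> ^ (p ^ n)) (int p ^ Suc n)"
      using p prime_imp_coprime[of "int p" \<beta>] by (simp add: coprime_commute)
    ultimately have "[?a = ?b] (mod int p ^ Suc n)" by (simp only: cong_mult_lcancel)
    then show ?thesis by (simp add: cong_iff_dvd_diff)
  qed
  note dvd = this
  show ?thesis
  proof (rule ccontr)
    assume "?a \<noteq> ?b"
    then have ne: "?a - ?b \<noteq> 0" by simp
    \<comment> \<open>An exponent this large makes the power of \<open>p\<close> exceed the nonzero
      difference it would have to divide.\<close>
    let ?k = "nat \<bar>?a - ?b\<bar>"
    have "int ?k < int (p ^ Suc ?k)" using p0 power_gt_expt[of p "Suc ?k"] by linarith
    then have "\<bar>?a - ?b\<bar> < int p ^ Suc ?k" by (simp only: of_nat_power nat_0_le abs_ge_zero)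
    moreover have "\<bar>int p ^ Suc ?k\<bar> \<le> \<bar>?a - ?b\<bar>" by (rule dvd_imp_le_int[OF ne dvd])
    ultimately show False by linarith
  qed
qed

text \<open>After one \<open>p\<close>-th power step the induction hypothesis is applied to the
  pulled-back predicate, hence \<open>P\<close> is left arbitrary.\<close>

lemma class_aug_prime_power_map_iterate:
  fixes u :: "'a \<Rightarrow>\<^sub>0 int"
  assumes u: "Poly_Mapping.keys u \<subseteq> carrier G"
    and uu: "\<And>g. Poly_Mapping.lookup (convolution G u u) g = \<beta> * Poly_Mapping.lookup u g"
    and p: "prime p" "\<not> int p dvd \<beta>" and P: "class_pred G P"
  shows "class_aug u {g. P g} = class_aug u {g. P (g [^] (p ^ a))}"
  using P
proof (induction a arbitrary: P)
  case 0
  show ?case using u by (intro class_aug_cong) auto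
next
  case (Suc a)
  have "class_aug u {g. P g} = class_aug u {g. P ((g [^] (p ^ a)) [^] p)}"
    using class_aug_prime_power_map[OF u uu p Suc.prems] Suc.IH[OF class_pred_pow[OF Suc.prems]] by simp
  also have "\<dots> = class_aug u {g. P (g [^] (p ^ Suc a))}"
    using u by (intro class_aug_cong) (auto simp: nat_pow_pow mult.commute)
  finally show ?case .
qed

section \<open>Evaluation of the Moebius sum over power classes\<close>

text \<open>A conjugation invariant set is a union of classes; the support inside it is grouped by
  class.\<close>

lemma sum_class_aug_class_pred:
  fixes u :: "'a \<Rightarrow>\<^sub>0 int"
  assumes u: "Poly_Mapping.keys u \<subseteq> carrier G" and R: "class_pred G R"
  shows "(\<Sum>X\<in>{X \<in> {conj_class G x | x. x \<in> carrier G \<and> R x}. class_aug u X \<noteq> 0}. class_aug u X)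
    = class_aug u {g. R g}"
proof -
  let ?S = "{g. R g} \<inter> Poly_Mapping.keys u"
  have fibre: "{x \<in> ?S. conj_class G x = conj_class G g} = conj_class G g \<inter> Poly_Mapping.keys u"
    if "g \<in> ?S" for g
  proof -
    have g: "g \<in> carrier G" "R g" using that u by auto
    show ?thesis
      using u conj_class_self conj_class_eq[OF g(1)] class_pred_conj_class[OF R g(1)] g(2) by blast
  qed
  have "class_aug u {g. R g} = (\<Sum>X\<in>conj_class G ` ?S. \<Sum>g\<in>{x \<in> ?S. conj_class G x = X}. Poly_Mapping.lookup u g)"
    unfolding class_aug_def by (rule sum.group[symmetric]) auto
  also have "\<dots> = (\<Sum>X\<in>conj_class G ` ?S. class_aug u X)"
  proof (rule sum.cong[OF refl])
    fix X assume "X \<in> conj_class G ` ?S"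
    then obtain g where "g \<in> ?S" "X = conj_class G g" by blast
    then show "(\<Sum>g\<in>{x \<in> ?S. conj_class G x = X}. Poly_Mapping.lookup u g) = class_aug u X"
      using fibre by (simp add: class_aug_def)
  qed
  \<comment> \<open>A class with nonzero augmentation meets the support; classes meeting it with
    augmentation zero drop out.\<close>
  also have "\<dots> = (\<Sum>X\<in>{X \<in> {conj_class G x | x. x \<in> carrier G \<and> R x}. class_aug u X \<noteq> 0}. class_aug u X)"
  proof (rule sum.mono_neutral_right)
    show "{X \<in> {conj_class G x | x. x \<in> carrier G \<and> R x}. class_aug u X \<noteq> 0} \<subseteq> conj_class G ` ?S"
    proof
      fix X assume X: "X \<in> {X \<in> {conj_class G x | x. x \<in> carrier G \<and> R x}. class_aug u X \<noteq> 0}"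
      then obtain x where x: "x \<in> carrier G" "R x" "X = conj_class G x" by blast
      have "X \<inter> Poly_Mapping.keys u \<noteq> {}" using X unfolding class_aug_def by auto
      then obtain g where g: "g \<in> X" "g \<in> Poly_Mapping.keys u" by blast
      then have "R g" using class_pred_conj_class[OF R x(1)] x by blast
      then show "X \<in> conj_class G ` ?S" using g x conj_class_eq[OF x(1)] by blast
    qed
  qed (use u in auto)
  finally show ?thesis by simp
qed

text \<open>Since \<open>q * r div t = q div (t div r)\<close>, the inner sum depends only on
  \<open>d = t div r\<close>. Moebius inversion leaves the term \<open>d = q'\<close>, whose root
  condition asks for an \<open>m\<close>-th root of \<open>g [^] m\<close>.\<close>

lemma moebius_class_sum_eq:
  fixes u :: "'a \<Rightarrow>\<^sub>0 int"
  assumes u: "Poly_Mapping.keys u \<subseteq> carrier G" and s: "s \<in> carrier G"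
    and q: "q > 0" "q = q' * m"
  shows "moebius_class_sum G q q' m u s = class_aug u {g. g [^] m \<in> conj_class G s}"
proof -
  define R where "R k z \<longleftrightarrow> z \<in> conj_class G s \<and> (\<exists>y\<in>carrier G. y [^] (k::nat) = z)" for k z
  define F where "F d = class_aug u {g. R (q div d) (g [^] m)}" for d
  have R: "class_pred G (R k)" for k
    using class_pred_in_conj_class[OF s] class_pred_is_power[of k]
    unfolding R_def class_pred_def by auto
  have inner: "(\<Sum>X\<in>{X \<in> power_classes G q m r t s. class_aug u X \<noteq> 0}. class_aug u X) = F (t div r)"
    if rt: "r dvd t" "t dvd q'" for r t
  proof -
    obtain d where t: "t = r * d" using rt by auto
    obtain k where k: "q = t * k" using rt q by auto
    have "r > 0" "d > 0" using t k q by (auto intro: Nat.gr0I)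
    then have "q * r div t = q div (t div r)" using t k by simp
    then show ?thesis
      using sum_class_aug_class_pred[OF u class_pred_pow[OF R]]
      by (simp add: power_classes_def F_def R_def)
  qed
  have q': "q' > 0" "q div q' = m" using q by auto
  have "moebius_class_sum G q q' m u s = (\<Sum>(r, t) | r dvd t \<and> t dvd q'. moebius r * F (t div r))"
    unfolding moebius_class_sum_def by (intro sum.cong refl) (auto simp: inner)
  also have "\<dots> = F q'" by (rule sum_moebius_chains[OF q'(1)])
  \<comment> \<open>The element \<open>g\<close> itself is the required root.\<close>
  also have "\<dots> = class_aug u {g. g [^] m \<in> conj_class G s}"
    unfolding F_def R_def q' using u by (intro class_aug_cong) auto
  finally show ?thesis .
qed

end

theorem corollary1:
  fixes G :: "('g, 'm) monoid_scheme"
    and e :: "'g \<Rightarrow>\<^sub>0 rat" and u :: "'g \<Rightarrow>\<^sub>0 int"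
    and \<beta> :: int and p q q' m :: nat
  assumes "group G"
    and "e \<in> carrier (group_ring G)" and "e \<otimes>\<^bsub>group_ring G\<^esub> e = e"
    and "u \<in> carrier (group_ring G)"
    and "\<And>g. g \<in> carrier G \<Longrightarrow> of_int (Poly_Mapping.lookup u g) = of_int \<beta> * Poly_Mapping.lookup e g"
    and "prime p"
    and "q > 0" and "q = q' * m" and "m = p ^ multiplicity p q" and "\<not> p dvd q'"
    and "\<not> int p dvd \<beta>"
  shows "(\<forall>s\<in>carrier G. [partial_aug G u s = moebius_class_sum G q q' m u s] (mod int p)) \<and>
    (finite (carrier G) \<longrightarrow>
     real p > 4 * real q' * real_of_int \<bar>\<beta>\<bar> * real (order G) powr (3 / 2) \<longrightarrow>
     (\<forall>s\<in>carrier G. partial_aug G u s = moebius_class_sum G q q' m u s))"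
proof -
  interpret group G by fact
  have keys: "Poly_Mapping.keys e \<subseteq> carrier G" "Poly_Mapping.keys u \<subseteq> carrier G"
    using assms(2,4) by (auto simp: group_ring_def)
  \<comment> \<open>Outside the carrier both coefficients vanish.\<close>
  have "of_int (Poly_Mapping.lookup u g) = of_int \<beta> * Poly_Mapping.lookup e g" for g
  proof (cases "g \<in> carrier G")
    case False
    then have "g \<notin> Poly_Mapping.keys e" "g \<notin> Poly_Mapping.keys u" using keys by auto
    then show ?thesis by (simp add: in_keys_iff)
  qed (rule assms(5))
  then have uu: "Poly_Mapping.lookup (convolution G u u) g = \<beta> * Poly_Mapping.lookup u g" for g
    using assms(3) by (intro convolution_scaled_idempotent[of G e]) (simp_all add: group_ring_def)
  have "partial_aug G u s = moebius_class_sum G q q' m u s" if s: "s \<in> carrier G" for s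
  proof -
    have "partial_aug G u s = class_aug u {g. g \<in> conj_class G s}" by (simp add: partial_aug_def)
    \<comment> \<open>As \<open>m\<close> is a power of \<open>p\<close>, the map from
      \<open>g\<close> to its \<open>m\<close>-th power is an iterated \<open>p\<close>-th power
      map.\<close>
    also have "\<dots> = class_aug u {g. g [^]\<^bsub>G\<^esub> m \<in> conj_class G s}"
      unfolding assms(9)
      by (rule class_aug_prime_power_map_iterate[OF keys(2) uu assms(6,11) class_pred_in_conj_class[OF s]])
    also have "\<dots> = moebius_class_sum G q q' m u s"
      using moebius_class_sum_eq[OF keys(2) s assms(7,8)] by simp
    finally show ?thesis .
  qed
  then show ?thesis by simp
qed

end
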